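(* There is a locally compact (Polish) group $G$ such that for every $n\in\mathbb{N}$ the diagonal conjugation action of $G$ on $G^{n+1}$ has a dense orbit; for example, $G=\mathrm{Iso}(X^2_{\mathbb{N}^{>0}})$ is such a group.
   Context: For a countable $R\subseteq \mathbb{R}^{>0}$ and a natural number $n$, the Polish ultrametric $n$-Urysohn space is $$X^n_R=\{x\in\{0,\ldots,n-1\}^R: \text{for every } r>0 \text{ the set } \{r'\in R: r'>r,\ x(r')\neq 0\}\text{ is finite}\},$$ with the ultrametric $d(x,y)=\max\{r\in R: x(r)\neq y(r)\}$ for $x\ne y$. $\mathbb{N}^{>0}$ denotes the set of positive natural numbers. $\mathrm{Iso}(X)$ is the group of all distance-preserving bijections of $X$ with the topology of pointwise convergence. The diagonal conjugation action of $G$ on $G^{n+1}$ ($n\in\mathbb{N}$, including $n=0$) is $g.(g_0,\ldots,g_n)=(gg_0g^{-1},\ldots,gg_ng^{-1})$. *)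

theory Defs
  imports "HOL-Analysis.Analysis" "HOL-Algebra.Group_Action"
begin

section \<open>The Polish ultrametric \<open>n\<close>-Urysohn space\<close>

text \<open>Functions on \<open>R\<close> are represented extensionally, so that equality of points is equality on
  \<open>R\<close>. The intended parameters are countable sets \<open>R\<close> of positive reals.\<close>

definition urysohn :: "nat \<Rightarrow> real set \<Rightarrow> (real \<Rightarrow> nat) set" where
  "urysohn n R = {x \<in> R \<rightarrow>\<^sub>E {0..<n}. \<forall>r>0. finite {r' \<in> R. r' > r \<and> x r' \<noteq> 0}}"

text \<open>The set of places where two points differ may be infinite (accumulating at \<open>0\<close>), so the
  library's \<open>Max\<close>, which is meant for finite sets, would be wrong here; \<open>GREATEST\<close> is the
  maximum of an arbitrary set that has one. The value \<open>0\<close> off the space is needed because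
  \<^locale>\<open>Metric_space\<close> requires \<open>d\<close> to be nonnegative and symmetric on the whole type.\<close>

definition urysohn_dist :: "nat \<Rightarrow> real set \<Rightarrow> (real \<Rightarrow> nat) \<Rightarrow> (real \<Rightarrow> nat) \<Rightarrow> real" where
  "urysohn_dist n R x y =
     (if x \<in> urysohn n R \<and> y \<in> urysohn n R \<and> x \<noteq> y
      then (GREATEST r. r \<in> R \<and> x r \<noteq> y r) else 0)"

lemma urysohn_diff_max:
  assumes R: "R \<subseteq> {0<..}" and x: "x \<in> urysohn n R" and y: "y \<in> urysohn n R" and "x \<noteq> y"
  obtains m where "m \<in> R" "x m \<noteq> y m" "\<And>r. r \<in> R \<Longrightarrow> x r \<noteq> y r \<Longrightarrow> r \<le> m"
proof -
  obtain r0 where r0: "r0 \<in> R" "x r0 \<noteq> y r0"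
    using PiE_ext[of x R "\<lambda>_. {0..<n}" y] x y \<open>x \<noteq> y\<close> unfolding urysohn_def by blast
  define F where "F = {r \<in> R. r > r0 \<and> x r \<noteq> y r}"
  have "F \<subseteq> {r \<in> R. r > r0 \<and> x r \<noteq> 0} \<union> {r \<in> R. r > r0 \<and> y r \<noteq> 0}"
    unfolding F_def by auto
  moreover have "r0 > 0" using R r0 by auto
  ultimately have fin: "finite (insert r0 F)"
    using x y unfolding urysohn_def by (auto intro: finite_subset)
  define m where "m = Max (insert r0 F)"
  have "m \<in> insert r0 F" unfolding m_def using fin by (intro Max_in) auto
  then have m: "m \<in> R" "x m \<noteq> y m" using r0 unfolding F_def by auto
  have "r \<le> m" if "r \<in> R" "x r \<noteq> y r" for r
  proof (cases "r > r0")
    case True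
    then show ?thesis unfolding m_def using fin that by (intro Max_ge) (auto simp: F_def)
  next
    case False
    moreover have "r0 \<le> m" unfolding m_def using fin by (intro Max_ge) auto
    ultimately show ?thesis by simp
  qed
  with m show thesis by (rule that)
qed

lemma urysohn_dist_max:
  assumes "R \<subseteq> {0<..}" "x \<in> urysohn n R" "y \<in> urysohn n R" "x \<noteq> y"
  shows "urysohn_dist n R x y \<in> R" "x (urysohn_dist n R x y) \<noteq> y (urysohn_dist n R x y)"
    and "\<And>r. r \<in> R \<Longrightarrow> x r \<noteq> y r \<Longrightarrow> r \<le> urysohn_dist n R x y"
proof -
  obtain m where m: "m \<in> R" "x m \<noteq> y m" "\<And>r. r \<in> R \<Longrightarrow> x r \<noteq> y r \<Longrightarrow> r \<le> m"
    using urysohn_diff_max[OF assms] by blast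
  have "(GREATEST r. r \<in> R \<and> x r \<noteq> y r) = m"
    using m by (intro Greatest_equality) auto
  then have "urysohn_dist n R x y = m" using assms by (simp add: urysohn_dist_def)
  with m show "urysohn_dist n R x y \<in> R" "x (urysohn_dist n R x y) \<noteq> y (urysohn_dist n R x y)"
    "\<And>r. r \<in> R \<Longrightarrow> x r \<noteq> y r \<Longrightarrow> r \<le> urysohn_dist n R x y" by auto
qed

lemma urysohn_dist_pos:
  assumes "R \<subseteq> {0<..}" "x \<in> urysohn n R" "y \<in> urysohn n R" "x \<noteq> y"
  shows "0 < urysohn_dist n R x y"
  using urysohn_dist_max(1)[OF assms] assms(1) by auto

lemma urysohn_dist_nonneg:
  assumes "R \<subseteq> {0<..}"
  shows "0 \<le> urysohn_dist n R x y"
proof (cases "x \<in> urysohn n R \<and> y \<in> urysohn n R \<and> x \<noteq> y")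
  case True
  then show ?thesis using urysohn_dist_pos[OF assms, of x n y] by simp
next
  case False
  then show ?thesis by (auto simp: urysohn_dist_def)
qed

lemma urysohn_dist_ultra:
  assumes R: "R \<subseteq> {0<..}" and "x \<in> urysohn n R" "y \<in> urysohn n R" "z \<in> urysohn n R"
  shows "urysohn_dist n R x z \<le> max (urysohn_dist n R x y) (urysohn_dist n R y z)"
proof (cases "x = z")
  case True
  have "urysohn_dist n R x z = 0" using True by (simp add: urysohn_dist_def)
  then show ?thesis using urysohn_dist_nonneg[OF R, of n x y] by simp
next
  case False
  let ?m = "urysohn_dist n R x z"
  have m: "?m \<in> R" "x ?m \<noteq> z ?m"
    using urysohn_dist_max[OF R, of x n z] assms False by auto
  then consider "x ?m \<noteq> y ?m" | "y ?m \<noteq> z ?m" by metis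
  then show ?thesis
  proof cases
    case 1
    then have "x \<noteq> y" by auto
    then have "?m \<le> urysohn_dist n R x y"
      using urysohn_dist_max(3)[OF R assms(2,3) _ m(1) 1] by blast
    then show ?thesis by simp
  next
    case 2
    then have "y \<noteq> z" by auto
    then have "?m \<le> urysohn_dist n R y z"
      using urysohn_dist_max(3)[OF R assms(3,4) _ m(1) 2] by blast
    then show ?thesis by simp
  qed
qed

lemma Metric_space_urysohn:
  assumes R: "R \<subseteq> {0<..}"
  shows "Metric_space (urysohn n R) (urysohn_dist n R)"
proof
  fix x y z
  show "0 \<le> urysohn_dist n R x y" by (rule urysohn_dist_nonneg[OF R])
  show "urysohn_dist n R x y = urysohn_dist n R y x"
  proof -
    have "(\<lambda>r. r \<in> R \<and> x r \<noteq> y r) = (\<lambda>r. r \<in> R \<and> y r \<noteq> x r)" by (intro ext) metis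
    then show ?thesis unfolding urysohn_dist_def by (metis (mono_tags))
  qed
  assume xy: "x \<in> urysohn n R" "y \<in> urysohn n R"
  show "urysohn_dist n R x y = 0 \<longleftrightarrow> x = y"
    using urysohn_dist_pos[OF R xy] by (cases "x = y") (auto simp: urysohn_dist_def)
  assume "z \<in> urysohn n R"
  then show "urysohn_dist n R x z \<le> urysohn_dist n R x y + urysohn_dist n R y z"
    using urysohn_dist_ultra[OF R xy, of z] urysohn_dist_nonneg[OF R, of n x y]
      urysohn_dist_nonneg[OF R, of n y z] by (simp add: max_def split: if_splits)
qed

section \<open>Isometry groups\<close>

definition isometries :: "'a set \<Rightarrow> ('a \<Rightarrow> 'a \<Rightarrow> real) \<Rightarrow> ('a \<Rightarrow> 'a) set" where
  "isometries M d = {f \<in> Bij M. \<forall>x\<in>M. \<forall>y\<in>M. d (f x) (f y) = d x y}"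

definition Iso :: "'a set \<Rightarrow> ('a \<Rightarrow> 'a \<Rightarrow> real) \<Rightarrow> ('a \<Rightarrow> 'a) monoid" where
  "Iso M d = BijGroup M\<lparr>carrier := isometries M d\<rparr>"

definition Iso_topology :: "'a set \<Rightarrow> ('a \<Rightarrow> 'a \<Rightarrow> real) \<Rightarrow> ('a \<Rightarrow> 'a) topology" where
  "Iso_topology M d =
     subtopology (product_topology (\<lambda>_. Metric_space.mtopology M d) M) (isometries M d)"

section \<open>Topological groups and diagonal conjugation\<close>

definition topological_group :: "('a, 'b) monoid_scheme \<Rightarrow> 'a topology \<Rightarrow> bool" where
  "topological_group G T \<longleftrightarrow>
     group G \<and> topspace T = carrier G \<and>
     continuous_map (prod_topology T T) T (\<lambda>(g, h). g \<otimes>\<^bsub>G\<^esub> h) \<and>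
     continuous_map T T (\<lambda>g. inv\<^bsub>G\<^esub> g)"

definition locally_compact_Polish_group :: "('a, 'b) monoid_scheme \<Rightarrow> 'a topology \<Rightarrow> bool" where
  "locally_compact_Polish_group G T \<longleftrightarrow>
     topological_group G T \<and> completely_metrizable_space T \<and> separable_space T \<and>
     locally_compact_space T"

text \<open>An element of the power \<open>G\<^sup>n\<^sup>+\<^sup>1\<close> is an extensional function on the index set
  \<open>{0, \<dots>, n}\<close>, which is written \<open>{..n}\<close>.\<close>

definition diag_conj :: "('a, 'b) monoid_scheme \<Rightarrow> nat \<Rightarrow> 'a \<Rightarrow> (nat \<Rightarrow> 'a) \<Rightarrow> nat \<Rightarrow> 'a" where
  "diag_conj G n g =
     (\<lambda>u \<in> {..n} \<rightarrow>\<^sub>E carrier G. \<lambda>i \<in> {..n}. g \<otimes>\<^bsub>G\<^esub> u i \<otimes>\<^bsub>G\<^esub> inv\<^bsub>G\<^esub> g)"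

definition dense_diag_conj_orbit :: "('a, 'b) monoid_scheme \<Rightarrow> 'a topology \<Rightarrow> nat \<Rightarrow> bool" where
  "dense_diag_conj_orbit G T n \<longleftrightarrow>
     (\<exists>u \<in> {..n} \<rightarrow>\<^sub>E carrier G.
        product_topology (\<lambda>_. T) {..n} closure_of orbit G (diag_conj G n) u
          = {..n} \<rightarrow>\<^sub>E carrier G)"

end

theory Submission
  imports Defs
begin

text \<open>Balls of the Urysohn space over the positive integers are finite, so pointwise convergence
  of isometries means agreement on larger and larger balls around a base point. For density, a
  sequence of isometries carries balls \<open>B\<^sub>k\<close> around the base point, with radii tending to infinity,
  to pairwise disjoint balls \<open>C\<^sub>k\<close>. By the ultrametric inequality, isometries chosen independently on
  the \<open>C\<^sub>k\<close> glue to an isometry of the whole space. Planting on the \<open>C\<^sub>k\<close> transported copies of all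
  the tuples of a countable dense family produces a tuple which, conjugated back by the \<open>k\<close>-th
  isometry, agrees with the \<open>k\<close>-th planted tuple on \<open>B\<^sub>k\<close>.\<close>

section \<open>Isometry groups of ultrametric spaces with finite balls\<close>

text \<open>Finite closed balls make the space discrete and countable. The balls
  \<open>mcball z r\<close> exhaust \<open>M\<close> and serve as the scale on which isometries are
  compared.\<close>

locale finite_ball_ultrametric = Metric_space M d for M :: "'a set" and d +
  fixes z
  assumes ultra: "\<lbrakk>x \<in> M; y \<in> M; w \<in> M\<rbrakk> \<Longrightarrow> d x w \<le> max (d x y) (d y w)"
    and finite_mcball: "finite (mcball x r)"
    and base_in [simp, intro]: "z \<in> M"
begin

abbreviation G where "G \<equiv> Iso M d"
abbreviation T where "T \<equiv> Iso_topology M d"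
abbreviation P where "P \<equiv> product_topology (\<lambda>_. mtopology) M"

text \<open>For fixed \<open>r\<close> an equivalence relation; as \<open>r\<close> grows, its
  classes form a neighbourhood base for pointwise convergence. For negative \<open>r\<close> the
  ball is empty and any two maps agree.\<close>

definition agree :: "real \<Rightarrow> ('a \<Rightarrow> 'a) \<Rightarrow> ('a \<Rightarrow> 'a) \<Rightarrow> bool" where
  "agree r f g \<longleftrightarrow> (\<forall>x\<in>mcball z r. f x = g x)"

lemma agree_refl [simp]: "agree r f f"
  by (simp add: agree_def)

lemma agree_mono: "agree s f g \<Longrightarrow> r \<le> s \<Longrightarrow> agree r f g"
  by (auto simp: agree_def)

lemma agree_trans: "agree r f g \<Longrightarrow> agree r g h \<Longrightarrow> agree r f h"
  by (auto simp: agree_def)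

lemma finite_subset_mcball:
  assumes "finite A" "A \<subseteq> M"
  obtains r where "A \<subseteq> mcball z r"
proof
  show "A \<subseteq> mcball z (Max (insert 0 (d z ` A)))"
    using assms by (auto intro!: Max_ge)
qed

text \<open>Finite sets are closed in a Hausdorff space, so removing the finitely many points other
  than the centre from an open ball leaves an open singleton.\<close>

lemma mtopology_discrete: "mtopology = discrete_topology M"
proof -
  have "openin mtopology {x}" if "x \<in> M" for x
  proof -
    have "finite (mcball x 1 - {x})"
      using finite_mcball by blast
    then have "closedin mtopology (mcball x 1 - {x})"
      by (intro closedin_Hausdorff_finite Hausdorff_space_mtopology) auto
    then have "openin mtopology (mball x 1 - (mcball x 1 - {x}))"
      by (intro openin_diff) auto
    also have "mball x 1 - (mcball x 1 - {x}) = {x}"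
      using that by auto
    finally show ?thesis .
  qed
  then show ?thesis
    by (intro discrete_topology_unique[THEN iffD2, symmetric]) auto
qed

lemma countable_M: "countable M"
proof -
  have "M \<subseteq> (\<Union>n::nat. mcball z (real n))"
  proof
    fix x assume "x \<in> M"
    moreover obtain n where "d z x \<le> real n"
      using real_arch_simple by blast
    ultimately show "x \<in> (\<Union>n::nat. mcball z (real n))"
      by auto
  qed
  then show ?thesis
    by (rule countable_subset) (simp add: countable_finite finite_mcball)
qed

subsection \<open>Isometries\<close>

lemma isometries_PiE: "f \<in> isometries M d \<Longrightarrow> f \<in> M \<rightarrow>\<^sub>E M"
  by (auto simp: isometries_def Bij_def bij_betw_def PiE_def)

lemma isometries_in [simp]: "f \<in> isometries M d \<Longrightarrow> x \<in> M \<Longrightarrow> f x \<in> M"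
  using isometries_PiE by blast

lemma isometries_dist [simp]:
  "f \<in> isometries M d \<Longrightarrow> x \<in> M \<Longrightarrow> y \<in> M \<Longrightarrow> d (f x) (f y) = d x y"
  by (auto simp: isometries_def)

text \<open>A distance-preserving map preserves every large enough ball around \<open>z\<close>, and an injective
  self-map of a finite ball is onto.\<close>

lemma isometriesI:
  assumes f: "f \<in> M \<rightarrow>\<^sub>E M" and iso: "\<And>x y. x \<in> M \<Longrightarrow> y \<in> M \<Longrightarrow> d (f x) (f y) = d x y"
  shows "f \<in> isometries M d"
proof -
  have fM: "f x \<in> M" if "x \<in> M" for x
    using f that by auto
  have inj: "inj_on f M"
  proof (rule inj_onI)
    fix x y assume "x \<in> M" "y \<in> M" "f x = f y"
    then show "x = y"
      using iso[of x y] fM by simp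
  qed
  have "y \<in> f ` M" if y: "y \<in> M" for y
  proof -
    \<comment> \<open>The first bound puts \<open>y\<close> in the ball; the second makes
      \<open>f\<close> map the ball into itself.\<close>
    define r where "r = max (d z y) (d z (f z))"
    have "f ` mcball z r \<subseteq> mcball z r"
    proof clarsimp
      fix x assume x: "x \<in> M" "d z x \<le> r"
      have "d z (f x) \<le> max (d z (f z)) (d z x)"
        using ultra[of z "f z" "f x"] x iso[of z x] fM by auto
      then show "f x \<in> M \<and> d z (f x) \<le> r"
        using x fM by (auto simp: r_def)
    qed
    moreover have "inj_on f (mcball z r)"
      using inj by (rule inj_on_subset) auto
    ultimately have "f ` mcball z r = mcball z r"
      using endo_inj_surj finite_mcball by metis
    moreover have "y \<in> mcball z r"
      using y by (auto simp: r_def)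
    ultimately have "y \<in> f ` mcball z r"
      by simp
    then show ?thesis
      by auto
  qed
  then have "bij_betw f M M"
    using inj fM by (auto simp: bij_betw_def)
  then show ?thesis
    using f iso by (auto simp: isometries_def Bij_def PiE_def)
qed

text \<open>With surjectivity supplied by \<open>isometriesI\<close>, only conditions on pairs of
  points remain; this is what makes the isometries a closed set of maps.\<close>

lemma isometries_iff:
  "f \<in> isometries M d \<longleftrightarrow> f \<in> M \<rightarrow>\<^sub>E M \<and> (\<forall>x\<in>M. \<forall>y\<in>M. d (f x) (f y) = d x y)"
  using isometriesI isometries_PiE by auto

text \<open>Tells how far a radius must grow to absorb the image of a ball under an isometry;
  continuity of the group operations rests on it.\<close>

lemma dist_base_image_le:
  assumes "f \<in> isometries M d" "x \<in> M"
  shows "d z (f x) \<le> max (d z (f z)) (d z x)"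
  using ultra[of z "f z" "f x"] assms by auto

section \<open>The isometry group and its operations evaluated at points\<close>

lemma isometries_subgroup: "subgroup (isometries M d) (BijGroup M)"
proof (rule group.subgroupI[OF group_BijGroup])
  have id: "(\<lambda>x\<in>M. x) \<in> isometries M d"
    by (intro isometriesI) auto
  then show "isometries M d \<noteq> {}"
    by blast
  show "isometries M d \<subseteq> carrier (BijGroup M)"
    by (auto simp: isometries_def BijGroup_def)
  fix f assume f: "f \<in> isometries M d"
  then have fB: "f \<in> Bij M"
    by (auto simp: isometries_def)
  then have bij: "bij_betw f M M"
    by (auto simp: Bij_def)
  have inv: "inv_into M f x \<in> M" "f (inv_into M f x) = x" if "x \<in> M" for x
    using bij that by (auto simp: bij_betw_inv_into_right Bij_inv_into_mem[OF fB])
  have "(\<lambda>x\<in>M. inv_into M f x) \<in> isometries M d"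
  proof (rule isometriesI)
    fix x y assume "x \<in> M" "y \<in> M"
    then show "d ((\<lambda>x\<in>M. inv_into M f x) x) ((\<lambda>x\<in>M. inv_into M f x) y) = d x y"
      using isometries_dist[OF f, of "inv_into M f x" "inv_into M f y"] inv by simp
  qed (use inv in auto)
  then show "inv\<^bsub>BijGroup M\<^esub> f \<in> isometries M d"
    by (simp add: inv_BijGroup[OF fB])
  fix g assume g: "g \<in> isometries M d"
  then have "compose M f g \<in> isometries M d"
    using f by (intro isometriesI) (auto simp: compose_def)
  then show "f \<otimes>\<^bsub>BijGroup M\<^esub> g \<in> isometries M d"
    using fB g by (auto simp: BijGroup_def isometries_def)
qed

lemma group_Iso: "group G"
  unfolding Iso_def by (rule subgroup.subgroup_is_group[OF isometries_subgroup group_BijGroup])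

sublocale Iso: group G
  by (rule group_Iso)

lemma carrier_Iso [simp]: "carrier G = isometries M d"
  by (simp add: Iso_def)

lemma Iso_mult_apply [simp]:
  "f \<in> isometries M d \<Longrightarrow> g \<in> isometries M d \<Longrightarrow> x \<in> M \<Longrightarrow> (f \<otimes>\<^bsub>G\<^esub> g) x = f (g x)"
  by (simp add: Iso_def BijGroup_def isometries_def compose_def)

lemma Iso_one_apply [simp]: "x \<in> M \<Longrightarrow> \<one>\<^bsub>G\<^esub> x = x"
  by (simp add: Iso_def BijGroup_def)

lemma Iso_inv_in [simp]: "f \<in> isometries M d \<Longrightarrow> inv\<^bsub>G\<^esub> f \<in> isometries M d"
  using Iso.inv_closed by simp

lemma Iso_mult_in [simp]:
  "f \<in> isometries M d \<Longrightarrow> g \<in> isometries M d \<Longrightarrow> f \<otimes>\<^bsub>G\<^esub> g \<in> isometries M d"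
  using Iso.m_closed by simp

lemma Iso_one_in [simp]: "\<one>\<^bsub>G\<^esub> \<in> isometries M d"
  using Iso.one_closed by simp

lemma Iso_inv_apply1 [simp]:
  assumes "f \<in> isometries M d" "x \<in> M" shows "(inv\<^bsub>G\<^esub> f) (f x) = x"
  using Iso_mult_apply[of "inv\<^bsub>G\<^esub> f" f x] assms by (simp add: Iso.l_inv)

lemma Iso_inv_apply2 [simp]:
  assumes "f \<in> isometries M d" "x \<in> M" shows "f ((inv\<^bsub>G\<^esub> f) x) = x"
  using Iso_mult_apply[of f "inv\<^bsub>G\<^esub> f" x] assms by (simp add: Iso.r_inv)

text \<open>Moving a point within a ball does not change its distance to points outside the ball,
  so isometries of disjoint balls can be combined freely.\<close>

lemma glue_isometries:
  fixes c :: "'i \<Rightarrow> 'a" and r :: "'i \<Rightarrow> real" and \<phi> :: "'i \<Rightarrow> 'a \<Rightarrow> 'a"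
  defines "C \<equiv> \<lambda>i. mcball (c i) (r i)"
  assumes c: "\<And>i. c i \<in> M"
    and \<phi>: "\<And>i. \<phi> i \<in> isometries M d" and move_c: "\<And>i. d (c i) (\<phi> i (c i)) \<le> r i"
    and disj: "\<And>i j. i \<noteq> j \<Longrightarrow> C i \<inter> C j = {}"
  obtains f where "f \<in> isometries M d" "\<And>i x. x \<in> C i \<Longrightarrow> f x = \<phi> i x"
    "\<And>x. x \<in> M \<Longrightarrow> (\<And>i. x \<notin> C i) \<Longrightarrow> f x = x"
proof
  \<comment> \<open>Disjointness makes the ball containing \<open>x\<close> unique, so the definite
    description picks it.\<close>
  define f where
    "f = (\<lambda>x\<in>M. if \<exists>i. x \<in> C i then \<phi> (THE i. x \<in> C i) x else x)"
  show in_C: "f x = \<phi> i x" if "x \<in> C i" for i x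
  proof -
    have "(THE i. x \<in> C i) = i"
      using disj that by (intro the_equality) auto
    then show ?thesis
      using that by (auto simp: f_def C_def)
  qed
  show not_C: "f x = x" if "x \<in> M" "\<And>i. x \<notin> C i" for x
    using that by (simp add: f_def)
  \<comment> \<open>By the ultrametric inequality it is enough that the centre stays in its
    ball.\<close>
  have \<phi>C: "\<phi> i x \<in> C i" if "x \<in> C i" for i x
    using that ultra[of "c i" "\<phi> i (c i)" "\<phi> i x"] \<phi>[of i] c[of i] move_c[of i] by (auto simp: C_def)
  have fM: "f x \<in> M" if "x \<in> M" for x
    using that \<phi> in_C not_C isometries_in by metis
  have far: "d x w = d y w" if "x \<in> C i" "y \<in> C i" "w \<in> M" "w \<notin> C i" for x y w i
  proof -
    \<comment> \<open>One inequality suffices by symmetry. Its failure would force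
      \<open>d x w \<le> d x y \<le> r i\<close> and so put \<open>w\<close> into the ball.\<close>
    have *: "d x w \<le> d y w" if xy: "x \<in> C i" "y \<in> C i" for x y
    proof (rule ccontr)
      assume "\<not> ?thesis"
      then have less: "d y w < d x w" by simp
      have M: "x \<in> M" "y \<in> M" and le: "d (c i) x \<le> r i" "d (c i) y \<le> r i"
        using xy by (auto simp: C_def)
      have "d x y \<le> r i"
        using ultra[of x "c i" y] M c le by (auto simp: commute)
      moreover have "d x w \<le> max (d x y) (d y w)"
        using ultra M \<open>w \<in> M\<close> by blast
      ultimately have "d x w \<le> r i"
        using less by auto
      then have "d (c i) w \<le> r i"
        using ultra[of "c i" x w] M c[of i] \<open>w \<in> M\<close> le by auto
      then show False
        using \<open>w \<in> M\<close> \<open>w \<notin> C i\<close> c by (auto simp: C_def)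
    qed
    show ?thesis
      using *[of x y] *[of y x] that by simp
  qed
  have fC: "f x \<in> C i \<longleftrightarrow> x \<in> C i" if "x \<in> M" for x i
    using that \<phi>C in_C not_C disj by (metis IntI emptyE)
  \<comment> \<open>Applied twice, moving one point at a time, this settles pairs of points that
    share no ball.\<close>
  have move: "d (f x) y = d x y" if "x \<in> M" "y \<in> M" "\<And>i. x \<in> C i \<Longrightarrow> y \<notin> C i" for x y
  proof (cases "\<exists>i. x \<in> C i")
    case True
    then obtain i where "x \<in> C i" by blast
    then show ?thesis
      using that far[of "f x" i x y] fC by simp
  next
    case False
    then show ?thesis
      using not_C that by auto
  qed
  show "f \<in> isometries M d"
  proof (rule isometriesI)
    show "f \<in> M \<rightarrow>\<^sub>E M"
      using fM by (auto simp: f_def)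
    fix x y assume xy: "x \<in> M" "y \<in> M"
    show "d (f x) (f y) = d x y"
    proof (cases "\<exists>i. x \<in> C i \<and> y \<in> C i")
      case True
      then obtain i where "x \<in> C i" "y \<in> C i" by blast
      then show ?thesis
        using in_C \<phi>[of i] xy by simp
    next
      case False
      then have "d (f x) (f y) = d x (f y)"
        using move[of x "f y"] xy fM fC by blast
      also have "\<dots> = d x y"
        using move[of y x] xy False by (simp add: commute) blast
      finally show ?thesis .
    qed
  qed
qed

subsection \<open>The topology of pointwise convergence\<close>

text \<open>A basic open set of the product constrains finitely many coordinates, all within one
  ball. Conversely, balls are finite and the factors discrete, so agreement on a ball is an open
  condition.\<close>

lemma openin_P_iff:
  "openin P U \<longleftrightarrow> U \<subseteq> (M \<rightarrow>\<^sub>E M) \<and>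
     (\<forall>f\<in>U. \<exists>r. \<forall>g\<in>M \<rightarrow>\<^sub>E M. agree r f g \<longrightarrow> g \<in> U)" (is "_ \<longleftrightarrow> ?R")
proof
  assume U: "openin P U"
  have "\<exists>r. \<forall>g\<in>M \<rightarrow>\<^sub>E M. agree r f g \<longrightarrow> g \<in> U" if f: "f \<in> U" for f
  proof -
    obtain X where X: "f \<in> Pi\<^sub>E M X" "finite {i \<in> M. X i \<noteq> M}" "Pi\<^sub>E M X \<subseteq> U"
      using U f unfolding openin_product_topology_alt by force
    obtain r where r: "{i \<in> M. X i \<noteq> M} \<subseteq> mcball z r"
      using finite_subset_mcball[OF X(2)] by blast
    have "g \<in> Pi\<^sub>E M X" if g: "g \<in> M \<rightarrow>\<^sub>E M" "agree r f g" for g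
    proof (rule PiE_I)
      fix x assume "x \<in> M"
      show "g x \<in> X x"
      proof (cases "X x = M")
        case False
        then have "f x = g x"
          using r g \<open>x \<in> M\<close> by (auto simp: agree_def)
        then show ?thesis
          using X(1) \<open>x \<in> M\<close> by (metis PiE_E)
      qed (use g \<open>x \<in> M\<close> in auto)
    qed (use g in auto)
    then show ?thesis
      using subsetD[OF X(3)] by meson
  qed
  moreover have "U \<subseteq> (M \<rightarrow>\<^sub>E M)"
    using openin_subset[OF U] by simp
  ultimately show ?R
    by simp
next
  assume R: ?R
  show "openin P U"
  proof (subst openin_subopen, rule ballI)
    fix f assume f: "f \<in> U"
    then have fP: "f \<in> M \<rightarrow>\<^sub>E M"
      using R by blast
    obtain r where r: "\<And>g. g \<in> M \<rightarrow>\<^sub>E M \<Longrightarrow> agree r f g \<Longrightarrow> g \<in> U"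
      using bspec[OF conjunct2[OF R] f] by meson
    define W where "W = Pi\<^sub>E M (\<lambda>x. if x \<in> mcball z r then {f x} else M)"
    have "openin P W"
      unfolding W_def openin_PiE_gen
    proof (intro disjI2 conjI ballI)
      show "finite {i \<in> M. (if i \<in> mcball z r then {f i} else M) \<noteq> topspace mtopology}"
        by (rule finite_subset[OF _ finite_mcball[of z r]]) auto
    qed (use fP in \<open>auto simp: mtopology_discrete\<close>)
    moreover have "f \<in> W"
      using fP by (auto simp: W_def PiE_iff)
    moreover have "W \<subseteq> U"
    proof
      fix g assume "g \<in> W"
      then have gx: "g x \<in> (if x \<in> mcball z r then {f x} else M)" if "x \<in> M" for x
        using that unfolding W_def by (rule PiE_mem)
      have "g \<in> extensional M"
        using \<open>g \<in> W\<close> by (auto simp: W_def PiE_def)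
      moreover have "g x \<in> M" if "x \<in> M" for x
        using gx[OF that] fP that by (auto split: if_splits)
      ultimately have "g \<in> M \<rightarrow>\<^sub>E M"
        by (auto simp: PiE_def)
      moreover have "agree r f g"
        unfolding agree_def
      proof
        fix x assume "x \<in> mcball z r"
        then show "f x = g x"
          using gx[of x] by simp
      qed
      ultimately show "g \<in> U"
        by (rule r)
    qed
    ultimately show "\<exists>W. openin P W \<and> f \<in> W \<and> W \<subseteq> U"
      by blast
  qed
qed

lemma T_eq: "T = subtopology P (isometries M d)"
  by (simp add: Iso_topology_def)

lemma topspace_T [simp]: "topspace T = isometries M d"
  using isometries_PiE by (auto simp: T_eq)

lemma openin_T_iff:
  "openin T U \<longleftrightarrow> U \<subseteq> isometries M d \<and>
     (\<forall>f\<in>U. \<exists>r. \<forall>g\<in>isometries M d. agree r f g \<longrightarrow> g \<in> U)" (is "_ \<longleftrightarrow> ?R")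
proof
  assume "openin T U"
  then obtain V where V: "openin P V" "U = V \<inter> isometries M d"
    by (auto simp: T_eq openin_subtopology)
  show ?R
  proof (intro conjI ballI)
    fix f assume "f \<in> U"
    then obtain r where "\<forall>g\<in>M \<rightarrow>\<^sub>E M. agree r f g \<longrightarrow> g \<in> V"
      using V unfolding openin_P_iff by (meson IntD1)
    then show "\<exists>r. \<forall>g\<in>isometries M d. agree r f g \<longrightarrow> g \<in> U"
      using V(2) isometries_PiE by (meson IntI)
  qed (use V in auto)
next
  assume R: ?R
  \<comment> \<open>By transitivity, the \<open>r\<close> of a member of \<open>V\<close> also
    serves every map agreeing with it on that ball, which makes \<open>V\<close> open.\<close>
  define V where "V = {f \<in> M \<rightarrow>\<^sub>E M. \<exists>r. \<forall>g\<in>isometries M d. agree r f g \<longrightarrow> g \<in> U}"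
  have "openin P V"
    unfolding openin_P_iff
  proof (intro conjI ballI)
    fix f assume "f \<in> V"
    then obtain r where "\<forall>g\<in>isometries M d. agree r f g \<longrightarrow> g \<in> U"
      by (auto simp: V_def)
    then have "\<forall>g\<in>M \<rightarrow>\<^sub>E M. agree r f g \<longrightarrow> g \<in> V"
      using agree_trans[of r f] by (auto simp: V_def)
    then show "\<exists>r. \<forall>g\<in>M \<rightarrow>\<^sub>E M. agree r f g \<longrightarrow> g \<in> V" ..
  qed (auto simp: V_def)
  moreover have "U \<subseteq> V \<inter> isometries M d"
    using R isometries_PiE by (simp add: V_def subset_iff)
  moreover have "V \<inter> isometries M d \<subseteq> U"
    using agree_refl by (auto simp: V_def)
  ultimately have "openin P V" "U = V \<inter> isometries M d"
    by auto
  then show "openin T U"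
    by (auto simp: T_eq openin_subtopology)
qed

text \<open>Agreement on a fixed ball is transitive, so the same radius works at every member of the
  set.\<close>

lemma openin_agree: "openin T {g \<in> isometries M d. agree r f g}"
  unfolding openin_T_iff
proof (intro conjI ballI)
  fix g assume "g \<in> {g \<in> isometries M d. agree r f g}"
  then show "\<exists>r'. \<forall>h\<in>isometries M d. agree r' g h \<longrightarrow> h \<in> {g \<in> isometries M d. agree r f g}"
    using agree_trans[of r f g] by auto
qed auto

text \<open>A map that is not an isometry distorts some pair of points, and so does every map
  agreeing with it on a ball containing that pair.\<close>

lemma closedin_isometries: "closedin P (isometries M d)"
  unfolding closedin_def
proof
  show "isometries M d \<subseteq> topspace P"
    using isometries_PiE by auto
  show "openin P (topspace P - isometries M d)"
    unfolding openin_P_iff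
  proof (intro conjI ballI)
    fix f assume "f \<in> topspace P - isometries M d"
    then obtain x y where xy: "x \<in> M" "y \<in> M" "d (f x) (f y) \<noteq> d x y"
      by (auto simp: isometries_iff)
    obtain r where "{x, y} \<subseteq> mcball z r"
      using finite_subset_mcball[of "{x, y}"] xy by auto
    then have "g \<notin> isometries M d" if "agree r f g" for g
      using xy that isometries_dist[of g x y] by (auto simp: agree_def)
    then show "\<exists>r. \<forall>g\<in>M \<rightarrow>\<^sub>E M. agree r f g \<longrightarrow> g \<in> topspace P - isometries M d"
      by auto
  qed auto
qed

section \<open>Continuity of multiplication and inversion\<close>

lemma topological_group_Iso: "topological_group G T"
  unfolding topological_group_def
proof (intro conjI)
  show "continuous_map (prod_topology T T) T (\<lambda>(g, h). g \<otimes>\<^bsub>G\<^esub> h)"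
    unfolding continuous_map_def
  proof (intro conjI allI impI)
    fix U assume U: "openin T U"
    show "openin (prod_topology T T) {x \<in> topspace (prod_topology T T). (case x of (g, h) \<Rightarrow> g \<otimes>\<^bsub>G\<^esub> h) \<in> U}"
      unfolding openin_prod_topology_alt
    proof clarsimp
      fix g h assume gh: "g \<in> isometries M d" "h \<in> isometries M d" "g \<otimes>\<^bsub>G\<^esub> h \<in> U"
      then obtain r where r: "\<And>f. f \<in> isometries M d \<Longrightarrow> agree r (g \<otimes>\<^bsub>G\<^esub> h) f \<Longrightarrow> f \<in> U"
        using U unfolding openin_T_iff by meson
      \<comment> \<open>\<open>h\<close> maps the ball of radius \<open>r\<close> into the ball of
        radius \<open>s\<close>, so that is where \<open>g\<close> has to be controlled.\<close>
      define s where "s = max r (d z (h z))"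
      define A where "A = {f \<in> isometries M d. agree s g f}"
      define B where "B = {f \<in> isometries M d. agree r h f}"
      have "openin T A" "openin T B"
        by (auto simp: A_def B_def openin_agree)
      moreover have "g \<in> A" "h \<in> B"
        using gh by (auto simp: A_def B_def)
      moreover have "A \<times> B \<subseteq> {x. (x \<in> isometries M d \<times> isometries M d) \<and> (case x of (g, h) \<Rightarrow> g \<otimes>\<^bsub>G\<^esub> h) \<in> U}"
      proof clarsimp
        fix g' h' assume *: "g' \<in> A" "h' \<in> B"
        then have iso: "g' \<in> isometries M d" "h' \<in> isometries M d"
          by (auto simp: A_def B_def)
        have "agree r (g \<otimes>\<^bsub>G\<^esub> h) (g' \<otimes>\<^bsub>G\<^esub> h')"
          unfolding agree_def
        proof
          fix x assume x: "x \<in> mcball z r"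
          then have "h x = h' x"
            using * by (auto simp: B_def agree_def)
          moreover have "h x \<in> mcball z s"
            using x gh(2) dist_base_image_le[of h x] by (auto simp: s_def)
          then have "g (h x) = g' (h x)"
            using * by (auto simp: A_def agree_def)
          ultimately show "(g \<otimes>\<^bsub>G\<^esub> h) x = (g' \<otimes>\<^bsub>G\<^esub> h') x"
            using gh iso x by simp
        qed
        then show "g' \<in> isometries M d \<and> h' \<in> isometries M d \<and> g' \<otimes>\<^bsub>G\<^esub> h' \<in> U"
          using r iso by simp
      qed
      ultimately show "\<exists>A. openin T A \<and> (\<exists>B. openin T B \<and> g \<in> A \<and> h \<in> B \<and>
          A \<times> B \<subseteq> {x. x \<in> isometries M d \<times> isometries M d \<and> (case x of (g, h) \<Rightarrow> g \<otimes>\<^bsub>G\<^esub> h) \<in> U})"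
        by blast
    qed
  qed auto
  show "continuous_map T T (\<lambda>g. inv\<^bsub>G\<^esub> g)"
    unfolding continuous_map_def
  proof (intro conjI allI impI)
    fix U assume U: "openin T U"
    show "openin T {g \<in> topspace T. inv\<^bsub>G\<^esub> g \<in> U}"
      unfolding openin_T_iff
    proof (intro conjI ballI)
      fix g assume "g \<in> {g \<in> topspace T. inv\<^bsub>G\<^esub> g \<in> U}"
      then have g: "g \<in> isometries M d" "inv\<^bsub>G\<^esub> g \<in> U"
        by auto
      then obtain r where r: "\<And>f. f \<in> isometries M d \<Longrightarrow> agree r (inv\<^bsub>G\<^esub> g) f \<Longrightarrow> f \<in> U"
        using U unfolding openin_T_iff by meson
      define s where "s = max r (d z ((inv\<^bsub>G\<^esub> g) z))"
      have "inv\<^bsub>G\<^esub> h \<in> U" if h: "h \<in> isometries M d" "agree s g h" for h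
      proof -
        have "agree r (inv\<^bsub>G\<^esub> g) (inv\<^bsub>G\<^esub> h)"
          unfolding agree_def
        proof
          fix x assume x: "x \<in> mcball z r"
          \<comment> \<open>\<open>g\<close> and \<open>h\<close> agree at \<open>y\<close>, so
            \<open>h\<close> also sends \<open>y\<close> to \<open>x\<close>, and both inverses send
            \<open>x\<close> to \<open>y\<close>.\<close>
          define y where "y = (inv\<^bsub>G\<^esub> g) x"
          have "y \<in> mcball z s"
            using x g dist_base_image_le[of "inv\<^bsub>G\<^esub> g" x] by (auto simp: s_def y_def)
          then have "h y = g y" and y: "y \<in> M"
            using h by (auto simp: agree_def)
          then have "h y = x"
            using x g by (simp add: y_def)
          then show "(inv\<^bsub>G\<^esub> g) x = (inv\<^bsub>G\<^esub> h) x"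
            using Iso_inv_apply1[OF h(1) y] by (simp add: y_def)
        qed
        then show ?thesis
          using r h by simp
      qed
      then show "\<exists>r. \<forall>h\<in>isometries M d. agree r g h \<longrightarrow> h \<in> {g \<in> topspace T. inv\<^bsub>G\<^esub> g \<in> U}"
        by auto
    qed auto
  qed auto
qed (auto simp: group_Iso)

section \<open>Complete metrizability, local compactness and separability\<close>

lemma completely_metrizable_Iso: "completely_metrizable_space T"
  unfolding T_eq
proof (rule completely_metrizable_space_closedin[OF _ closedin_isometries])
  \<comment> \<open>A product of completely metrizable spaces is completely metrizable if only
    countably many factors have more than one point.\<close>
  have "countable {i \<in> M. \<not> (\<exists>a. topspace mtopology \<subseteq> {a})}"
    by (rule countable_subset[OF _ countable_M]) auto
  then show "completely_metrizable_space P"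
    unfolding completely_metrizable_space_product_topology
    by (auto simp: mtopology_discrete completely_metrizable_space_discrete_topology)
qed

text \<open>Once \<open>z\<close> is sent to \<open>f z\<close>, every \<open>x\<close> must go to
  the finite ball of radius \<open>d z x\<close> about \<open>f z\<close>. The product of these
  balls is compact, and the isometries form a closed set.\<close>

lemma locally_compact_Iso: "locally_compact_space T"
  unfolding locally_compact_space_def
proof
  fix f assume "f \<in> topspace T"
  then have f: "f \<in> isometries M d"
    by simp
  define U where "U = {g \<in> isometries M d. g z = f z}"
  define K where "K = Pi\<^sub>E M (\<lambda>x. mcball (f z) (d z x)) \<inter> isometries M d"
  \<comment> \<open>Radius \<open>0\<close> suffices, its ball being \<open>{z}\<close>.\<close>
  have "\<exists>r. \<forall>h\<in>isometries M d. agree r g h \<longrightarrow> h \<in> U" if "g \<in> U" for g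
    using that by (intro exI[of _ 0]) (auto simp: agree_def U_def)
  then have "openin T U"
    unfolding openin_T_iff by (auto simp: U_def)
  moreover have "compactin P (Pi\<^sub>E M (\<lambda>x. mcball (f z) (d z x)))"
    unfolding compactin_PiE
    using finite_mcball by (auto simp: mtopology_discrete compactin_discrete_topology)
  then have "compactin T K"
    unfolding T_eq compactin_subtopology K_def
    using compact_Int_closedin closedin_isometries by blast
  moreover have "f \<in> U"
    using f by (simp add: U_def)
  moreover have "U \<subseteq> K"
  proof
    fix g assume "g \<in> U"
    then have g: "g \<in> isometries M d" "g z = f z"
      by (auto simp: U_def)
    then have "d (f z) (g x) = d z x" if "x \<in> M" for x
      using that isometries_dist[OF g(1), of z x] by simp
    then show "g \<in> K"
      using g f isometries_PiE[of g] by (auto simp: K_def PiE_iff)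
  qed
  ultimately show "\<exists>U K. openin T U \<and> compactin T K \<and> f \<in> U \<and> U \<subseteq> K"
    by blast
qed

text \<open>These isometries of finite support form a countable dense set. They yield separability
  and supply the entries of the tuples planted in the dense orbit construction.\<close>

definition finitary :: "('a \<Rightarrow> 'a) set" where
  "finitary = {f \<in> isometries M d. finite {x \<in> M. f x \<noteq> x}}"

lemma countable_finitary: "countable finitary"
proof -
  \<comment> \<open>The graph over the support is a finite subset of \<open>M \<times> M\<close> and
    determines \<open>f\<close>, which fixes all other points of \<open>M\<close>.\<close>
  define code where "code f = (\<lambda>x. (x, f x)) ` {x \<in> M. f x \<noteq> x}" for f :: "'a \<Rightarrow> 'a"
  have "code ` finitary \<subseteq> {A. finite A \<and> A \<subseteq> M \<times> M}"
    by (auto simp: code_def finitary_def)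
  moreover have "countable {A. finite A \<and> A \<subseteq> M \<times> M}"
    by (intro countable_Collect_finite_subset countable_SIGMA countable_M)
  ultimately have "countable (code ` finitary)"
    by (rule countable_subset)
  moreover have "inj_on code finitary"
  proof (rule inj_onI)
    fix f g assume fg: "f \<in> finitary" "g \<in> finitary" "code f = code g"
    have "(x, y) \<in> code h \<longleftrightarrow> x \<in> M \<and> h x \<noteq> x \<and> y = h x" for x y h
      by (auto simp: code_def)
    then have "f x = g x" if "x \<in> M" for x
      using fg(3) that by metis
    moreover have "f \<in> extensional M" "g \<in> extensional M"
      using fg isometries_PiE by (auto simp: finitary_def PiE_def)
    ultimately show "f = g"
      by (metis extensionalityI)
  qed
  ultimately show ?thesis
    using countable_image_inj_on by blast
qed

lemma finitary_dense:
  assumes f: "f \<in> isometries M d"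
  obtains g where "g \<in> finitary" "agree r f g"
proof -
  define s where "s = max r (d z (f z))"
  \<comment> \<open>Gluing with a single ball cuts \<open>f\<close> off outside it; \<open>s\<close>
    is large enough for \<open>f\<close> to keep the centre \<open>z\<close> in the ball.\<close>
  obtain g where g: "g \<in> isometries M d" "\<And>x. x \<in> mcball z s \<Longrightarrow> g x = f x"
    "\<And>x. x \<in> M \<Longrightarrow> x \<notin> mcball z s \<Longrightarrow> g x = x"
    using glue_isometries[of "\<lambda>_::unit. z" "\<lambda>_. f" "\<lambda>_. s"] f by (auto simp: s_def)
  have "{x \<in> M. g x \<noteq> x} \<subseteq> mcball z s"
    using g(3) by blast
  then have "g \<in> finitary"
    using g(1) finite_subset[OF _ finite_mcball] unfolding finitary_def by blast
  moreover have "agree r f g"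
    using g(2) by (auto simp: agree_def s_def)
  ultimately show thesis
    by (rule that)
qed

lemma separable_Iso: "separable_space T"
  unfolding separable_space_def
proof (intro exI conjI)
  show "countable finitary"
    by (rule countable_finitary)
  show sub: "finitary \<subseteq> topspace T"
    by (auto simp: finitary_def)
  have "f \<in> T closure_of finitary" if f: "f \<in> isometries M d" for f
    unfolding in_closure_of openin_T_iff
    using finitary_dense[OF f] f sub by (metis topspace_T subsetD)
  then show "T closure_of finitary = topspace T"
    using closure_of_subset_topspace by fastforce
qed

theorem locally_compact_Polish_Iso: "locally_compact_Polish_group G T"
  unfolding locally_compact_Polish_group_def
  using topological_group_Iso completely_metrizable_Iso separable_Iso locally_compact_Iso by blast

subsection \<open>Dense orbits of diagonal conjugation\<close>

text \<open>The index set being finite, the largest of the coordinatewise radii serves for all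
  coordinates.\<close>

lemma openin_power_agree:
  assumes I: "finite I" and W: "openin (product_topology (\<lambda>_. T) I) W" "w \<in> W"
  obtains r where
    "\<And>v. v \<in> I \<rightarrow>\<^sub>E isometries M d \<Longrightarrow> (\<And>i. i \<in> I \<Longrightarrow> agree r (w i) (v i)) \<Longrightarrow> v \<in> W"
proof -
  obtain X where X: "\<And>i. i \<in> I \<Longrightarrow> openin T (X i)" "w \<in> Pi\<^sub>E I X" "Pi\<^sub>E I X \<subseteq> W"
    using product_topology_open_contains_basis[OF W] by meson
  have "\<forall>i\<in>I. \<exists>r. \<forall>g\<in>isometries M d. agree r (w i) g \<longrightarrow> g \<in> X i"
    using X(1,2) unfolding openin_T_iff by (meson PiE_mem)
  then obtain r where r: "\<And>i g. i \<in> I \<Longrightarrow> g \<in> isometries M d \<Longrightarrow> agree (r i) (w i) g \<Longrightarrow> g \<in> X i"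
    by metis
  define s where "s = Max (insert 0 (r ` I))"
  have "v \<in> W" if v: "v \<in> I \<rightarrow>\<^sub>E isometries M d" "\<And>i. i \<in> I \<Longrightarrow> agree s (w i) (v i)" for v
  proof (rule subsetD[OF X(3)], rule PiE_I)
    fix i assume i: "i \<in> I"
    then have "r i \<le> s"
      using I by (auto simp: s_def)
    then show "v i \<in> X i"
      using r[OF i] v i agree_mono by blast
  qed (use v in auto)
  then show thesis
    by (rule that)
qed

text \<open>Dependent choice takes each radius at least as large as the preceding displacement of
  \<open>z\<close>, so \<open>r k < d z (t k z) \<le> r (Suc k)\<close>.\<close>

lemma escaping_isometries:
  assumes unbounded: "\<And>r. \<exists>t\<in>isometries M d. r < d z (t z)"
  obtains t :: "nat \<Rightarrow> 'a \<Rightarrow> 'a" and r :: "nat \<Rightarrow> real" where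
    "\<And>k. t k \<in> isometries M d" "\<And>k. real k \<le> r k" "\<And>k. r k < d z (t k z)"
    "strict_mono (\<lambda>k. d z (t k z))"
proof -
  define step where "step k tr \<longleftrightarrow> fst tr \<in> isometries M d \<and> real k \<le> snd tr \<and> snd tr < d z (fst tr z)"
    for k :: nat and tr :: "('a \<Rightarrow> 'a) \<times> real"
  have ex: "\<exists>tr. step k tr \<and> a \<le> snd tr" for k a
    using unbounded[of "max (real k) a"]
    by (auto simp: step_def intro!: exI[of _ "max (real k) a"])
  have "\<exists>f. \<forall>k. step k (f k) \<and> d z (fst (f k) z) \<le> snd (f (Suc k))"
    by (rule dependent_nat_choice[where Q = "\<lambda>_ tr tr'. d z (fst tr z) \<le> snd tr'"])
      (use ex in blast)+
  then obtain f where f: "\<And>k. step k (f k)" "\<And>k. d z (fst (f k) z) \<le> snd (f (Suc k))"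
    by blast
  have "strict_mono (\<lambda>k. d z (fst (f k) z))"
    unfolding strict_mono_Suc_iff using f unfolding step_def by (meson le_less_trans)
  then show thesis
    using that[of "\<lambda>k. fst (f k)" "\<lambda>k. snd (f k)"] f by (auto simp: step_def)
qed

theorem dense_diag_conj_orbit_Iso:
  assumes unbounded: "\<And>r. \<exists>t\<in>isometries M d. r < d z (t z)"
  shows "dense_diag_conj_orbit G T n"
proof -
  obtain t :: "nat \<Rightarrow> 'a \<Rightarrow> 'a" and r :: "nat \<Rightarrow> real" where
    t: "\<And>k. t k \<in> isometries M d" and r: "\<And>k. real k \<le> r k" "\<And>k. r k < d z (t k z)"
    and mono: "strict_mono (\<lambda>k. d z (t k z))"
    using escaping_isometries[OF unbounded] by blast
  \<comment> \<open>The radius is below the distance of the centre from \<open>z\<close>, so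
    triangles with apex \<open>z\<close> are isosceles. Each ball thus lies on one sphere about
    \<open>z\<close>, and different \<open>k\<close> give different spheres.\<close>
  have on_sphere: "d z x = d z (t k z)" if "x \<in> mcball (t k z) (r k)" for x k
  proof -
    have x: "x \<in> M" "d (t k z) x \<le> r k"
      using that by auto
    then have "d z x \<le> max (d z (t k z)) (d (t k z) x)" "d z (t k z) \<le> max (d z x) (d (t k z) x)"
      using ultra[of z "t k z" x] ultra[of z x "t k z"] t by (auto simp: commute)
    then show ?thesis
      using x r(2)[of k] by auto
  qed
  have disj: "mcball (t k z) (r k) \<inter> mcball (t l z) (r l) = {}" if "k \<noteq> l" for k l
    using that on_sphere strict_mono_eq[OF mono, of k l] by (metis disjoint_iff)

  define D where "D = {..n} \<rightarrow>\<^sub>E finitary"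
  have "countable D"
    unfolding D_def by (intro countable_PiE countable_finitary) auto
  have "D \<noteq> {}"
    using finitary_dense[OF Iso_one_in] by (auto simp: D_def PiE_eq_empty_iff)
  txt \<open>Every member of \<open>D\<close> has to be used for arbitrarily large \<open>k\<close>, hence the pairing function.\<close>
  define e where "e k = from_nat_into D (fst (prod_decode k))" for k
  have e: "e k i \<in> isometries M d" if "i \<le> n" for k i
    using from_nat_into[OF \<open>D \<noteq> {}\<close>] that by (auto simp: e_def D_def finitary_def PiE_iff)
  \<comment> \<open>An entry moving \<open>z\<close> by more than \<open>r k\<close> does not
    preserve the ball and gives way to the identity. Indices beyond \<open>n\<close> get the
    identity too, so that \<open>u\<close> is total.\<close>
  define p where "p i k = (if i \<le> n \<and> d z (e k i z) \<le> r k then e k i else \<one>\<^bsub>G\<^esub>)" for i k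
  have p: "p i k \<in> isometries M d" "d z (p i k z) \<le> r k" for i k
    using e r(1)[of k] by (auto simp: p_def)
  \<comment> \<open>Conjugation by \<open>t k\<close> carries \<open>p i k\<close> from the ball
    about \<open>z\<close> to the ball about \<open>t k z\<close>; each coordinate \<open>i\<close>
    is glued over all \<open>k\<close> at once.\<close>
  have "\<exists>f\<in>isometries M d. \<forall>k. \<forall>x\<in>mcball (t k z) (r k).
          f x = (t k \<otimes>\<^bsub>G\<^esub> p i k \<otimes>\<^bsub>G\<^esub> inv\<^bsub>G\<^esub> (t k)) x" for i
  proof (rule glue_isometries[of "\<lambda>k. t k z" "\<lambda>k. t k \<otimes>\<^bsub>G\<^esub> p i k \<otimes>\<^bsub>G\<^esub> inv\<^bsub>G\<^esub> (t k)" r])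
    show "d (t k z) ((t k \<otimes>\<^bsub>G\<^esub> p i k \<otimes>\<^bsub>G\<^esub> inv\<^bsub>G\<^esub> (t k)) (t k z)) \<le> r k" for k
      using t p by simp
  qed (use t p disj in \<open>simp; fail | blast\<close>)+
  then obtain u where u: "\<And>i. u i \<in> isometries M d"
    and u_eq: "\<And>i k x. x \<in> mcball (t k z) (r k) \<Longrightarrow>
                 u i x = (t k \<otimes>\<^bsub>G\<^esub> p i k \<otimes>\<^bsub>G\<^esub> inv\<^bsub>G\<^esub> (t k)) x"
    by metis
  have conj_u: "agree (r k) (p i k) (inv\<^bsub>G\<^esub> (t k) \<otimes>\<^bsub>G\<^esub> u i \<otimes>\<^bsub>G\<^esub> t k)" for i k
    unfolding agree_def
  proof
    fix x assume x: "x \<in> mcball z (r k)"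
    then have "t k x \<in> mcball (t k z) (r k)"
      using t by auto
    then show "p i k x = (inv\<^bsub>G\<^esub> (t k) \<otimes>\<^bsub>G\<^esub> u i \<otimes>\<^bsub>G\<^esub> t k) x"
      using u_eq[of "t k x" k i] x t p u by simp
  qed

  let ?PT = "product_topology (\<lambda>_. T) {..n}"
  let ?u = "restrict u {..n}"
  have u_in: "?u \<in> {..n} \<rightarrow>\<^sub>E carrier G"
    using u by auto
  have "w \<in> ?PT closure_of orbit G (diag_conj G n) ?u" if w: "w \<in> {..n} \<rightarrow>\<^sub>E isometries M d" for w
    unfolding in_closure_of
  proof (intro conjI allI impI)
    show "w \<in> topspace ?PT"
      using w by simp
    fix W assume "w \<in> W \<and> openin ?PT W"
    then obtain s where s: "\<And>v. v \<in> {..n} \<rightarrow>\<^sub>E isometries M d \<Longrightarrow>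
        (\<And>i. i \<in> {..n} \<Longrightarrow> agree s (w i) (v i)) \<Longrightarrow> v \<in> W"
      using openin_power_agree[of "{..n}" W w] by auto
    have "\<forall>i\<in>{..n}. \<exists>g\<in>finitary. agree s (w i) g"
      using finitary_dense w by (metis PiE_mem)
    then obtain q0 where q0: "\<And>i. i \<le> n \<Longrightarrow> q0 i \<in> finitary \<and> agree s (w i) (q0 i)"
      by (metis atMost_iff)
    define q where "q = restrict q0 {..n}"
    have q: "q \<in> D" "\<And>i. i \<le> n \<Longrightarrow> agree s (w i) (q i)"
      using q0 by (auto simp: q_def D_def)
    obtain m where m: "from_nat_into D m = q"
      using from_nat_into_surj[OF \<open>countable D\<close> q(1)] by blast
    \<comment> \<open>\<open>N\<close> bounds the agreement radius \<open>s\<close> and the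
      displacement of \<open>z\<close> by every entry of \<open>q\<close>, so that no entry of
      \<open>q\<close> is replaced by the identity.\<close>
    obtain N :: nat where N: "Max (insert s ((\<lambda>i. d z (q i z)) ` {..n})) \<le> real N"
      using real_arch_simple by blast
    \<comment> \<open>The first component selects \<open>q\<close> as the \<open>k\<close>-th tuple;
      the second makes \<open>r k\<close> large enough.\<close>
    define k where "k = prod_encode (m, N)"
    have "N \<le> k"
      unfolding k_def by (rule le_prod_encode_2)
    then have "real N \<le> r k"
      using r(1)[of k] by linarith
    with N have large: "Max (insert s ((\<lambda>i. d z (q i z)) ` {..n})) \<le> r k"
      by linarith
    have "s \<le> r k"
      using large by simp
    have p_eq: "p i k = q i" if "i \<le> n" for i
      using that large m by (simp add: p_def e_def k_def)
    \<comment> \<open>Acting by the inverse of \<open>t k\<close> brings the copy planted near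
      \<open>t k z\<close> back to \<open>z\<close>.\<close>
    define v where "v = diag_conj G n (inv\<^bsub>G\<^esub> (t k)) ?u"
    have v: "v i = inv\<^bsub>G\<^esub> (t k) \<otimes>\<^bsub>G\<^esub> u i \<otimes>\<^bsub>G\<^esub> t k" if "i \<le> n" for i
      using that u_in t by (simp add: v_def diag_conj_def)
    have "v \<in> W"
    proof (rule s)
      show "v \<in> {..n} \<rightarrow>\<^sub>E isometries M d"
      proof (rule PiE_I)
        show "v i = undefined" if "i \<notin> {..n}" for i
          using that u_in by (simp add: v_def diag_conj_def)
      qed (use t u v in simp)
      fix i assume "i \<in> {..n}"
      then have i: "i \<le> n" by simp
      have "agree s (q i) (v i)"
        using conj_u[of k i] p_eq[OF i] v[OF i] agree_mono \<open>s \<le> r k\<close> by simp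
      then show "agree s (w i) (v i)"
        using agree_trans q(2)[OF i] by blast
    qed
    moreover have "v \<in> orbit G (diag_conj G n) ?u"
      using t unfolding orbit_def v_def by auto
    ultimately show "\<exists>v. v \<in> orbit G (diag_conj G n) ?u \<and> v \<in> W"
      by blast
  qed
  moreover have "?PT closure_of orbit G (diag_conj G n) ?u \<subseteq> {..n} \<rightarrow>\<^sub>E isometries M d"
    using closure_of_subset_topspace[of ?PT] by simp
  ultimately have "?PT closure_of orbit G (diag_conj G n) ?u = {..n} \<rightarrow>\<^sub>E carrier G"
    by auto
  with u_in show ?thesis
    unfolding dense_diag_conj_orbit_def by blast
qed

end

section \<open>The Urysohn space over the positive integers\<close>

lemma urysohn_eqI:
  "x \<in> urysohn n R \<Longrightarrow> y \<in> urysohn n R \<Longrightarrow> (\<And>r. r \<in> R \<Longrightarrow> x r = y r) \<Longrightarrow> x = y"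
  unfolding urysohn_def by (auto intro: PiE_ext)

text \<open>The maximum depends only on the set of coordinates where the points differ. This is how
  coordinate flips are seen to be isometries.\<close>

lemma urysohn_dist_cong:
  assumes M: "x \<in> urysohn n R" "y \<in> urysohn n R" "x' \<in> urysohn n R" "y' \<in> urysohn n R"
    and eq: "\<And>r. r \<in> R \<Longrightarrow> x r = y r \<longleftrightarrow> x' r = y' r"
  shows "urysohn_dist n R x y = urysohn_dist n R x' y'"
proof -
  have "x = y \<longleftrightarrow> x' = y'"
    using M eq urysohn_eqI by metis
  moreover have "(\<lambda>r. r \<in> R \<and> x r \<noteq> y r) = (\<lambda>r. r \<in> R \<and> x' r \<noteq> y' r)"
    using eq by auto
  ultimately show ?thesis
    using M by (simp add: urysohn_dist_def)
qed

lemma le_urysohn_dist: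
  assumes "R \<subseteq> {0<..}" "x \<in> urysohn n R" "y \<in> urysohn n R" "r \<in> R" "x r \<noteq> y r"
  shows "r \<le> urysohn_dist n R x y"
  using urysohn_dist_max(3)[of R x n y r] assms by auto

lemma zero_in_urysohn: "n > 0 \<Longrightarrow> (\<lambda>r\<in>R. 0) \<in> urysohn n R"
  by (auto simp: urysohn_def)

text \<open>\<open>1 - x a\<close> swaps \<open>0\<close> and \<open>1\<close>, and changing one
  coordinate adds at most \<open>a\<close> to the support.\<close>

lemma urysohn_flip:
  assumes "x \<in> urysohn 2 R" "a \<in> R"
  shows "x(a := 1 - x a) \<in> urysohn 2 R"
proof -
  have "finite {r' \<in> R. r' > r \<and> (x(a := 1 - x a)) r' \<noteq> 0}" if "r > 0" for r
  proof (rule finite_subset)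
    show "{r' \<in> R. r' > r \<and> (x(a := 1 - x a)) r' \<noteq> 0} \<subseteq> insert a {r' \<in> R. r' > r \<and> x r' \<noteq> 0}"
      by auto
    show "finite (insert a {r' \<in> R. r' > r \<and> x r' \<noteq> 0})"
      using assms that by (simp add: urysohn_def)
  qed
  then show ?thesis
    using assms by (auto simp: urysohn_def PiE_iff extensional_def)
qed

text \<open>Points of a ball of radius \<open>s\<close> agree with its centre at all coordinates
  above \<open>s\<close>, so they are determined by the finitely many coordinates up to
  \<open>s\<close>, each with \<open>n\<close> possible values.\<close>

lemma finite_ball_ultrametric_urysohn:
  assumes R: "R \<subseteq> {0<..}" and fin: "\<And>s. finite {r \<in> R. r \<le> s}" and n: "n > 0"
  shows "finite_ball_ultrametric (urysohn n R) (urysohn_dist n R) (\<lambda>r\<in>R. 0)"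
proof -
  interpret Metric_space "urysohn n R" "urysohn_dist n R"
    by (rule Metric_space_urysohn[OF R])
  show ?thesis
  proof
    show "finite (mcball x s)" for x s
    proof -
      let ?F = "{r \<in> R. r \<le> s}"
      have "(\<lambda>y. restrict y ?F) ` mcball x s \<subseteq> ?F \<rightarrow>\<^sub>E {0..<n}"
      proof (rule image_subsetI)
        fix y assume "y \<in> mcball x s"
        then have "y \<in> urysohn n R"
          by simp
        then have "y \<in> R \<rightarrow>\<^sub>E {0..<n}"
          by (simp add: urysohn_def)
        then show "restrict y ?F \<in> ?F \<rightarrow>\<^sub>E {0..<n}"
          by (simp add: restrict_PiE_iff PiE_iff)
      qed
      then have "finite ((\<lambda>y. restrict y ?F) ` mcball x s)"
        by (rule finite_subset) (intro finite_PiE fin, simp)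
      moreover have "inj_on (\<lambda>y. restrict y ?F) (mcball x s)"
      proof (rule inj_onI)
        fix y w assume yw: "y \<in> mcball x s" "w \<in> mcball x s" "restrict y ?F = restrict w ?F"
        show "y = w"
        proof (rule urysohn_eqI)
          fix r assume r: "r \<in> R"
          show "y r = w r"
          proof (cases "r \<le> s")
            case True
            then show ?thesis
              using fun_cong[OF yw(3), of r] r by simp
          next
            case False
            then have "x r = y r" "x r = w r"
              using le_urysohn_dist[OF R, of x n _ r] r yw by force+
            then show ?thesis by simp
          qed
        qed (use yw in auto)
      qed
      ultimately show ?thesis
        by (rule finite_imageD)
    qed
  qed (use R n in \<open>auto intro: urysohn_dist_ultra zero_in_urysohn simp del: restrict_apply\<close>)
qed

theorem corollary6p4:
  shows "(\<exists>(G :: ((real \<Rightarrow> nat) \<Rightarrow> (real \<Rightarrow> nat)) monoid) T.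
            locally_compact_Polish_group G T \<and> (\<forall>n. dense_diag_conj_orbit G T n)) \<and>
         (let R = real ` {0<..};
              G = Iso (urysohn 2 R) (urysohn_dist 2 R);
              T = Iso_topology (urysohn 2 R) (urysohn_dist 2 R)
          in locally_compact_Polish_group G T \<and> (\<forall>n. dense_diag_conj_orbit G T n))"
proof -
  define R where "R = real ` {0<..}"
  have R: "R \<subseteq> {0<..}"
    by (auto simp: R_def)
  have fin: "finite {r \<in> R. r \<le> s}" for s
  proof (rule finite_subset)
    show "{r \<in> R. r \<le> s} \<subseteq> real ` {..nat \<lfloor>s\<rfloor>}"
      by (auto simp: R_def le_nat_floor)
  qed auto
  interpret finite_ball_ultrametric "urysohn 2 R" "urysohn_dist 2 R" "\<lambda>r\<in>R. 0"
    by (rule finite_ball_ultrametric_urysohn[OF R fin]) simp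
  define z :: "real \<Rightarrow> nat" where "z = (\<lambda>r\<in>R. 0)"
  have z: "z \<in> urysohn 2 R"
    unfolding z_def by (rule base_in)
  have "\<exists>t\<in>isometries (urysohn 2 R) (urysohn_dist 2 R). s < urysohn_dist 2 R z (t z)" for s
  proof -
    obtain k where k: "s < real k" "k > 0"
      using reals_Archimedean2[of "max s 0"] by auto
    define a where "a = real k"
    have a: "a \<in> R"
      using k by (simp add: a_def R_def)
    \<comment> \<open>The flip at \<open>a\<close> changes \<open>z\<close> at \<open>a\<close>
      alone, hence moves it by at least \<open>a\<close>, which can be taken arbitrarily
      large.\<close>
    define t where "t = (\<lambda>x\<in>urysohn 2 R. x(a := 1 - x a))"
    \<comment> \<open>Truncated subtraction from \<open>1\<close> is injective on the values
      \<open>0\<close> and \<open>1\<close>, but not beyond.\<close>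
    have less: "x a < 2" if "x \<in> urysohn 2 R" for x
      using that a by (auto simp: urysohn_def PiE_iff)
    have "t \<in> isometries (urysohn 2 R) (urysohn_dist 2 R)"
    proof (rule isometriesI)
      show "t \<in> urysohn 2 R \<rightarrow>\<^sub>E urysohn 2 R"
        using urysohn_flip[OF _ a] by (auto simp: t_def)
      fix x y assume xy: "x \<in> urysohn 2 R" "y \<in> urysohn 2 R"
      show "urysohn_dist 2 R (t x) (t y) = urysohn_dist 2 R x y"
      proof (rule urysohn_dist_cong)
        show "t x r = t y r \<longleftrightarrow> x r = y r" for r
          using xy less[OF xy(1)] less[OF xy(2)] by (cases "r = a") (auto simp: t_def)
      qed (use xy urysohn_flip[OF _ a] in \<open>simp_all add: t_def\<close>)
    qed
    moreover have "t z = z(a := 1 - z a)"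
      using z by (simp add: t_def)
    then have "a \<le> urysohn_dist 2 R z (t z)"
      using le_urysohn_dist[OF R z urysohn_flip[OF z a] a] a by (simp add: z_def)
    then have "s < urysohn_dist 2 R z (t z)"
      using k by (simp add: a_def)
    ultimately show ?thesis
      by blast
  qed
  then have "\<And>n. dense_diag_conj_orbit G T n"
    unfolding z_def by (rule dense_diag_conj_orbit_Iso)
  \<comment> \<open>The concrete group also witnesses the existential claim.\<close>
  with locally_compact_Polish_Iso show ?thesis
    unfolding Let_def R_def by blast
qed

end
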